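(* Let $n,d\in\mathbb N$ and $f=\sum_{\alpha}f_\alpha x^\alpha\in C_{n,2d}$. Then $$\sum_{\beta\in\mathcal I(f)}|f_\beta|\;\le\;\sum_{\alpha\in\mathcal S(f)\setminus\mathcal R(f)}f_\alpha .$$ Moreover, if equality holds in this inequality, then for every cancellation-free SONC decomposition of $f$ (in the sense of the context) with scalars $\mu_{\alpha\beta}^{(k)},\nu_\beta^{(k)},\lambda_{\alpha\beta}^{(k)}\ge 0$, one has $$\mu_{\alpha\beta}^{(k)}f_\alpha=\nu_\beta^{(k)}\lambda_{\alpha\beta}^{(k)}|f_\beta|\qquad\text{for all }\beta\in\mathcal I(f),\ k\in\{1,\dots,N(\beta)\},\ \alpha\in\mathcal S(f)\setminus\mathcal R(f).$$
   Context: $\mathbb N=\{1,2,\dots\}$, $\mathbb N_0=\mathbb N\cup\{0\}$. $H_{n,k}$ is the real vector space of forms (homogeneous polynomials) of degree $k$ in $x=(x_1,\dots,x_n)$ with real coefficients. For $f=\sum_\alpha f_\alpha x^\alpha\in H_{n,2d}$: $\operatorname{supp}(f)=\{\alpha\in\mathbb N_0^n: f_\alpha\ne0\}$; $\operatorname{New}(f)=\operatorname{conv}(\operatorname{supp}(f))$; $V(f)$ is the set of vertices of $\operatorname{New}(f)$; $\mathcal S(f)=\{\alpha\in\operatorname{supp}(f):\alpha\in(2\mathbb N_0)^n,\ f_\alpha>0\}$; $\mathcal I(f)=\operatorname{supp}(f)\setminus\mathcal S(f)$. $\operatorname{relint}$ denotes relative interior; $V(\Delta)$ is the vertex set of a polytope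 $\Delta$. A simplex in $\mathbb R^n$ is a polytope whose vertex set is affinely independent. A form $f\in H_{n,2d}$ is a circuit if (C1) $\mathcal S(f)=V(f)$ and $V(f)$ is affinely independent, and (C2) either $\mathcal I(f)=\emptyset$, or $\mathcal I(f)=\{\beta\}$ with $\beta\in\operatorname{relint}(\operatorname{New}(f))$. It is a nonnegative circuit if moreover $f(v)\ge0$ for all $v\in\mathbb R^n$. (Single points and the empty set count as affinely independent.) $C_{n,2d}$ is the set of all finite sums of nonnegative circuits in $H_{n,2d}$ (SONC forms). For $\beta\in\mathcal I(f)$ let $\mathcal D(\beta)$ be the set of all simplices $\Delta\subseteq\mathbb R^n$ with $V(\Delta)\subseteq\mathcal S(f)$ and $\beta\in\operatorname{relint}(\Delta)$; write $N(\beta)=|\mathcal D(\beta)|$ and $\mathcal D(\beta)=\{\Delta_1,\dots,\Delta_{N(\beta)}\}$ (the enumeration depends on $\beta$). Let $\mathcal R(f)=\{\alpha\in\mathcal S(f):\alpha\notin\bigcup_{\beta\in\mathcal I(f)}\bigcup_{\Delta\in\mathcal D(\beta)}V(\Delta)\}$. For $\beta\in\mathcal I(f)$, $k\le N(\beta)$, and $\alpha\in V(\Delta_k)$, $\lambda_{\alpha\beta}^{(k)}>0$ denote the barycentric coordinates of $\beta$ in $\Delta_k$, i.e. $\beta=\sum_{\alpha\in V(\Delta_k)}\lambda_{\alpha\beta}^{(k)}\alpha$, $\sum_{\alpha\in V(\Delta_k)}\lambda_{\alpha\beta}^{(k)}=1$; for $\alpha\in\mathcal S(f)\setminus(\mathcal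 R(f)\cup V(\Delta_k))$ set $\lambda_{\alpha\beta}^{(k)}=0$. A cancellation-free SONC decomposition of $f$ is an expression $$f=\sum_{\beta\in\mathcal I(f)}\sum_{k=1}^{N(\beta)}f_{\beta k}+\sum_{\alpha\in\mathcal R(f)}f_\alpha x^\alpha,\qquad f_{\beta k}=\Big[\sum_{\alpha\in\mathcal S(f)\setminus\mathcal R(f)}\mu_{\alpha\beta}^{(k)}f_\alpha x^\alpha\Big]+\nu_\beta^{(k)}f_\beta x^\beta,$$ where each $f_{\beta k}$ is a nonnegative circuit with $\operatorname{New}(f_{\beta k})=\Delta_k\in\mathcal D(\beta)$ supported on $V(\Delta_k)\cup\{\beta\}$, all $\mu_{\alpha\beta}^{(k)},\nu_\beta^{(k)}\ge0$, $\sum_{\beta\in\mathcal I(f)}\sum_{k=1}^{N(\beta)}\mu_{\alpha\beta}^{(k)}=1$ for all $\alpha\in\mathcal S(f)\setminus\mathcal R(f)$, $\sum_{k=1}^{N(\beta)}\nu_\beta^{(k)}=1$ for all $\beta\in\mathcal I(f)$, and $\mu_{\alpha\beta}^{(k)}=0$ if and only if $\lambda_{\alpha\beta}^{(k)}=0$. *)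

theory Defs
  imports "HOL-Analysis.Analysis" "HOL-Library.Poly_Mapping"
begin

text \<open>
  A real polynomial in the variables \<open>x\<^sub>i\<close>, \<open>i \<in> UNIV :: 'n set\<close>, is the finitely supported map
  sending an exponent vector \<open>\<alpha> :: nat ^ 'n\<close> to the coefficient of \<open>x\<^sup>\<alpha>\<close>; \<^const>\<open>Poly_Mapping.single\<close> \<open>\<alpha> c\<close>
  is the monomial \<open>c x\<^sup>\<alpha>\<close>.
\<close>

type_synonym 'n mpoly = "(nat ^ 'n) \<Rightarrow>\<^sub>0 real"

abbreviation supp :: "'n::finite mpoly \<Rightarrow> (nat ^ 'n) set" where
  "supp f \<equiv> Poly_Mapping.keys f"

abbreviation coef :: "'n::finite mpoly \<Rightarrow> nat ^ 'n \<Rightarrow> real" where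
  "coef f \<alpha> \<equiv> Poly_Mapping.lookup f \<alpha>"

definition poly_eval :: "'n::finite mpoly \<Rightarrow> real ^ 'n \<Rightarrow> real" where
  "poly_eval f v = (\<Sum>\<alpha>\<in>supp f. coef f \<alpha> * (\<Prod>i\<in>UNIV. (v $ i) ^ (\<alpha> $ i)))"

definition forms :: "nat \<Rightarrow> 'n::finite mpoly set" where
  "forms k = {f. \<forall>\<alpha>\<in>supp f. (\<Sum>i\<in>UNIV. \<alpha> $ i) = k}"

definition pt :: "nat ^ 'n \<Rightarrow> real ^ 'n" where
  "pt \<alpha> = (\<chi> i. real (\<alpha> $ i))"

definition vertices :: "(real ^ 'n) set \<Rightarrow> (real ^ 'n) set" where
  "vertices P = {v. v extreme_point_of P}"

definition New :: "'n::finite mpoly \<Rightarrow> (real ^ 'n) set" where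
  "New f = convex hull (pt ` supp f)"

definition S_supp :: "'n::finite mpoly \<Rightarrow> (nat ^ 'n) set" where
  "S_supp f = {\<alpha>\<in>supp f. (\<forall>i. even (\<alpha> $ i)) \<and> coef f \<alpha> > 0}"

definition I_supp :: "'n::finite mpoly \<Rightarrow> (nat ^ 'n) set" where
  "I_supp f = supp f - S_supp f"

definition circuits :: "nat \<Rightarrow> 'n::finite mpoly set" where
  "circuits d = {f \<in> forms (2 * d).
     pt ` S_supp f = vertices (New f) \<and>
     \<not> affine_dependent (vertices (New f)) \<and>
     (I_supp f = {} \<or> (\<exists>\<beta>. I_supp f = {\<beta>} \<and> pt \<beta> \<in> rel_interior (New f)))}"

definition nonneg_circuits :: "nat \<Rightarrow> 'n::finite mpoly set" where
  "nonneg_circuits d = {f \<in> circuits d. \<forall>v. poly_eval f v \<ge> 0}"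

definition SONC :: "nat \<Rightarrow> 'n::finite mpoly set" where
  "SONC d = {f. \<exists>(m::nat) g. (\<forall>i<m. g i \<in> nonneg_circuits d) \<and> f = (\<Sum>i<m. g i)}"

definition is_simplex :: "(real ^ 'n::finite) set \<Rightarrow> bool" where
  "is_simplex T \<longleftrightarrow> polytope T \<and> \<not> affine_dependent (vertices T)"

lemma is_simplex_iff: "is_simplex T \<longleftrightarrow> (\<exists>k. k simplex T)"
proof
  assume T: "is_simplex T"
  then have "T = convex hull (vertices T)"
    unfolding is_simplex_def vertices_def
    by (auto intro!: Krein_Milman_Minkowski simp: polytope_imp_compact polytope_imp_convex)
  with T have "int (card (vertices T)) - 1 simplex T"
    by (auto simp: is_simplex_def simplex_def)
  then show "\<exists>k. k simplex T" ..
next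
  assume "\<exists>k. k simplex T"
  then obtain C where C: "\<not> affine_dependent C" "T = convex hull C"
    by (auto simp: simplex_def)
  then have "vertices T = C"
    by (auto simp: vertices_def extreme_point_of_convex_hull_affine_independent)
  with C show "is_simplex T"
    using aff_independent_finite by (auto simp: is_simplex_def polytope_def)
qed

definition D_simplices :: "'n::finite mpoly \<Rightarrow> nat ^ 'n \<Rightarrow> (real ^ 'n) set set" where
  "D_simplices f \<beta> = {T. is_simplex T \<and> vertices T \<subseteq> pt ` S_supp f \<and> pt \<beta> \<in> rel_interior T}"

lemma finite_D_simplices: "finite (D_simplices f \<beta>)"
proof (rule finite_subset)
  show "D_simplices f \<beta> \<subseteq> (\<lambda>V. convex hull V) ` Pow (pt ` S_supp f)"
  proof
    fix T assume T: "T \<in> D_simplices f \<beta>"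
    then have "T = convex hull (vertices T)"
      unfolding D_simplices_def is_simplex_def vertices_def
      by (auto intro!: Krein_Milman_Minkowski simp: polytope_imp_compact polytope_imp_convex)
    with T show "T \<in> (\<lambda>V. convex hull V) ` Pow (pt ` S_supp f)"
      by (auto simp: D_simplices_def)
  qed
  show "finite ((\<lambda>V. convex hull V) ` Pow (pt ` S_supp f))"
    by (simp add: S_supp_def)
qed

definition N_simplices :: "'n::finite mpoly \<Rightarrow> nat ^ 'n \<Rightarrow> nat" where
  "N_simplices f \<beta> = card (D_simplices f \<beta>)"

definition R_supp :: "'n::finite mpoly \<Rightarrow> (nat ^ 'n) set" where
  "R_supp f = {\<alpha>\<in>S_supp f. pt \<alpha> \<notin> (\<Union>\<beta>\<in>I_supp f. \<Union>T\<in>D_simplices f \<beta>. vertices T)}"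

text \<open>\<open>\<Delta> \<beta> 1, \<dots>, \<Delta> \<beta> (N_simplices f \<beta>)\<close> lists the simplices of \<open>D_simplices f \<beta>\<close> without repetition.\<close>

definition simplex_enumeration ::
  "'n::finite mpoly \<Rightarrow> (nat ^ 'n \<Rightarrow> nat \<Rightarrow> (real ^ 'n) set) \<Rightarrow> bool" where
  "simplex_enumeration f \<Delta> \<longleftrightarrow>
     (\<forall>\<beta>\<in>I_supp f. bij_betw (\<Delta> \<beta>) {1..N_simplices f \<beta>} (D_simplices f \<beta>))"

text \<open>
  The scalars with indices \<open>\<alpha>\<close>, \<open>\<beta>\<close> and superscript \<open>(k)\<close> are written \<open>lam \<alpha> \<beta> k\<close>,
  \<open>mu \<alpha> \<beta> k\<close> and \<open>nu \<beta> k\<close>. Affine independence of the vertices makes the \<open>lam \<alpha> \<beta> k\<close> below unique.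
\<close>

definition barycentric_coords ::
  "'n::finite mpoly \<Rightarrow> (nat ^ 'n \<Rightarrow> nat \<Rightarrow> (real ^ 'n) set) \<Rightarrow>
   (nat ^ 'n \<Rightarrow> nat ^ 'n \<Rightarrow> nat \<Rightarrow> real) \<Rightarrow> bool" where
  "barycentric_coords f \<Delta> lam \<longleftrightarrow>
     (\<forall>\<beta>\<in>I_supp f. \<forall>k\<in>{1..N_simplices f \<beta>}.
        let W = {\<alpha>\<in>S_supp f. pt \<alpha> \<in> vertices (\<Delta> \<beta> k)} in
          (\<forall>\<alpha>\<in>W. lam \<alpha> \<beta> k > 0) \<and>
          (\<Sum>\<alpha>\<in>W. lam \<alpha> \<beta> k) = 1 \<and>
          (\<Sum>\<alpha>\<in>W. lam \<alpha> \<beta> k *\<^sub>R pt \<alpha>) = pt \<beta> \<and>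
          (\<forall>\<alpha>\<in>S_supp f - (R_supp f \<union> W). lam \<alpha> \<beta> k = 0))"

definition summand ::
  "'n::finite mpoly \<Rightarrow> (nat ^ 'n \<Rightarrow> nat ^ 'n \<Rightarrow> nat \<Rightarrow> real) \<Rightarrow> (nat ^ 'n \<Rightarrow> nat \<Rightarrow> real) \<Rightarrow>
   nat ^ 'n \<Rightarrow> nat \<Rightarrow> 'n mpoly" where
  "summand f mu nu \<beta> k =
     (\<Sum>\<alpha>\<in>S_supp f - R_supp f. Poly_Mapping.single \<alpha> (mu \<alpha> \<beta> k * coef f \<alpha>)) +
     Poly_Mapping.single \<beta> (nu \<beta> k * coef f \<beta>)"

text \<open>
  As \<open>nu \<beta> k = 0\<close> is admitted, ``supported on'' in the following definition means that the support
  is contained in the given set.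
\<close>

definition cancellation_free_decomposition ::
  "nat \<Rightarrow> 'n::finite mpoly \<Rightarrow> (nat ^ 'n \<Rightarrow> nat \<Rightarrow> (real ^ 'n) set) \<Rightarrow>
   (nat ^ 'n \<Rightarrow> nat ^ 'n \<Rightarrow> nat \<Rightarrow> real) \<Rightarrow> (nat ^ 'n \<Rightarrow> nat ^ 'n \<Rightarrow> nat \<Rightarrow> real) \<Rightarrow>
   (nat ^ 'n \<Rightarrow> nat \<Rightarrow> real) \<Rightarrow> bool" where
  "cancellation_free_decomposition d f \<Delta> lam mu nu \<longleftrightarrow>
     simplex_enumeration f \<Delta> \<and>
     barycentric_coords f \<Delta> lam \<and>
     f = (\<Sum>\<beta>\<in>I_supp f. \<Sum>k=1..N_simplices f \<beta>. summand f mu nu \<beta> k) +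
         (\<Sum>\<alpha>\<in>R_supp f. Poly_Mapping.single \<alpha> (coef f \<alpha>)) \<and>
     (\<forall>\<beta>\<in>I_supp f. \<forall>k\<in>{1..N_simplices f \<beta>}.
        summand f mu nu \<beta> k \<in> nonneg_circuits d \<and>
        New (summand f mu nu \<beta> k) = \<Delta> \<beta> k \<and>
        pt ` supp (summand f mu nu \<beta> k) \<subseteq> vertices (\<Delta> \<beta> k) \<union> {pt \<beta>} \<and>
        nu \<beta> k \<ge> 0 \<and>
        (\<forall>\<alpha>\<in>S_supp f - R_supp f. mu \<alpha> \<beta> k \<ge> 0 \<and> (mu \<alpha> \<beta> k = 0 \<longleftrightarrow> lam \<alpha> \<beta> k = 0))) \<and>
     (\<forall>\<alpha>\<in>S_supp f - R_supp f. (\<Sum>\<beta>\<in>I_supp f. \<Sum>k=1..N_simplices f \<beta>. mu \<alpha> \<beta> k) = 1) \<and>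
     (\<forall>\<beta>\<in>I_supp f. (\<Sum>k=1..N_simplices f \<beta>. nu \<beta> k) = 1)"

end

theory Submission
  imports Defs
begin

text \<open>
  A nonnegative circuit, evaluated at a point of \<open>{\<plusminus>1}\<^sup>n\<close> that makes its inner term negative, shows that
  its vertex coefficients sum to at least the modulus of the inner coefficient. Summing this over
  the circuits of \<open>f\<close> gives the inequality with \<open>\<S>(f)\<close> in place of \<open>\<S>(f) - \<R>(f)\<close>. To remove \<open>\<R>(f)\<close>,
  let \<open>U\<close> be the union of the smallest faces of \<open>conv \<S>(f)\<close> that contain some \<open>\<beta> \<in> \<I>(f)\<close>: a circuit whose
  inner exponent lies in \<open>U\<close> is supported in \<open>U\<close>, so the summation may be restricted to \<open>U\<close>, and
  Caratheodory's theorem with one prescribed vertex gives \<open>\<S>(f) \<inter> U \<subseteq> \<S>(f) - \<R>(f)\<close>.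

  In the case of equality, each summand of a cancellation-free decomposition attains equality in its own
  coefficient inequality. Hence it vanishes, minimally, at a sign vector; the vanishing gradient
  expresses \<open>\<beta>\<close> as a combination of the vertices, and the barycentric coordinates are unique.
\<close>

section \<open>Caratheodory's theorem with a prescribed vertex\<close>

lemma inj_pt: "inj pt"
  by (auto simp: inj_def pt_def vec_eq_iff)

text \<open>Descent on \<open>C\<close>: along an affine relation among its points the weights can
  be shifted until one of them vanishes. The relation is oriented so that the weight of
  \<open>a\<close> never decreases, hence \<open>a\<close> survives every step.\<close>

lemma caratheodory_pos:
  fixes C :: "'a::euclidean_space set"
  assumes "finite C" "a \<in> C" "\<And>x. x \<in> C \<Longrightarrow> u x > 0" "sum u C = 1"
    "(\<Sum>x\<in>C. u x *\<^sub>R x) = b"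
  shows "\<exists>B\<subseteq>C. a \<in> B \<and> \<not> affine_dependent B \<and> b \<in> rel_interior (convex hull B)"
  using assms
proof (induction C arbitrary: u rule: finite_psubset_induct)
  case (psubset C)
  show ?case
  proof (cases "affine_dependent C")
    case False
    have "b \<in> rel_interior (convex hull C)"
      using False psubset.prems by (auto simp: rel_interior_convex_hull_explicit)
    with False psubset.prems show ?thesis by blast
  next
    case True
    then obtain w0 where w0: "sum w0 C = 0" "\<exists>v\<in>C. w0 v \<noteq> 0" "(\<Sum>v\<in>C. w0 v *\<^sub>R v) = 0"
      using affine_dependent_explicit_finite[OF psubset.hyps(1)] by blast
    define w where "w = (if w0 a \<ge> 0 then w0 else (\<lambda>v. - w0 v))"
    have w: "sum w C = 0" "\<exists>v\<in>C. w v \<noteq> 0" "(\<Sum>v\<in>C. w v *\<^sub>R v) = 0" "w a \<ge> 0"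
      using w0 by (auto simp: w_def sum_negf)
    define Ng where "Ng = {x\<in>C. w x < 0}"
    have "Ng \<noteq> {}"
    proof
      assume "Ng = {}"
      then have "\<And>x. x \<in> C \<Longrightarrow> w x \<ge> 0" by (auto simp: Ng_def not_less)
      with w(1,2) show False
        using sum_nonneg_eq_0_iff[OF psubset.hyps(1), of w] by auto
    qed
    have fN: "finite Ng" using psubset.hyps(1) by (simp add: Ng_def)
    \<comment> \<open>\<open>s\<close> is the largest shift along \<open>w\<close> that keeps all
      weights nonnegative; it is attained at \<open>y\<close>, whose weight drops to 0.\<close>
    define s where "s = Min ((\<lambda>x. u x / (- w x)) ` Ng)"
    have "s \<in> (\<lambda>x. u x / (- w x)) ` Ng"
      unfolding s_def using fN \<open>Ng \<noteq> {}\<close> by (intro Min_in) auto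
    then obtain y where y: "y \<in> Ng" "s = u y / (- w y)" by auto
    have s_le: "s \<le> u x / (- w x)" if "x \<in> Ng" for x
      unfolding s_def using fN that by (intro Min_le) auto
    have "s > 0" using y psubset.prems(2)[of y] by (auto simp: Ng_def divide_pos_neg)
    define u' where "u' = (\<lambda>x. u x + s * w x)"
    have u'_nonneg: "u' x \<ge> 0" if "x \<in> C" for x
    proof (cases "w x < 0")
      case True
      then show ?thesis using s_le[of x] that by (auto simp: Ng_def u'_def field_simps)
    next
      case False
      then show ?thesis using psubset.prems(2)[OF that] \<open>s > 0\<close> by (auto simp: u'_def)
    qed
    have "u' y = 0" using y by (auto simp: u'_def Ng_def)
    have "u' a > 0" using psubset.prems(1,2) w(4) \<open>s > 0\<close>
      by (auto simp: u'_def intro!: add_pos_nonneg)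
    define C' where "C' = {x\<in>C. u' x > 0}"
    have z: "u' x = 0" if "x \<in> C - C'" for x
      using u'_nonneg[of x] that by (force simp: C'_def)
    have "y \<in> C - C'" using y \<open>u' y = 0\<close> by (auto simp: C'_def Ng_def)
    then have "C' \<subset> C" by (auto simp: C'_def)
    have "sum u' C' = sum u' C"
      using psubset.hyps(1) z by (intro sum.mono_neutral_left) (auto simp: C'_def)
    also have "\<dots> = 1" using psubset.prems(3) w(1)
      by (simp add: u'_def sum.distrib flip: sum_distrib_left)
    finally have 1: "sum u' C' = 1" .
    have "(\<Sum>x\<in>C'. u' x *\<^sub>R x) = (\<Sum>x\<in>C. u' x *\<^sub>R x)"
      using psubset.hyps(1) z by (intro sum.mono_neutral_left) (auto simp: C'_def)
    also have "\<dots> = (\<Sum>x\<in>C. u x *\<^sub>R x) + s *\<^sub>R (\<Sum>x\<in>C. w x *\<^sub>R x)"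
      by (simp add: u'_def sum.distrib scaleR_left_distrib scaleR_right.sum)
    also have "\<dots> = b" using psubset.prems(4) w(3) by simp
    finally have 2: "(\<Sum>x\<in>C'. u' x *\<^sub>R x) = b" .
    have "\<exists>B\<subseteq>C'. a \<in> B \<and> \<not> affine_dependent B \<and> b \<in> rel_interior (convex hull B)"
      using \<open>C' \<subset> C\<close> \<open>u' a > 0\<close> psubset.prems(1) 1 2
      by (intro psubset.IH[of C' u']) (auto simp: C'_def)
    with \<open>C' \<subset> C\<close> show ?thesis by blast
  qed
qed

text \<open>Mixing the weights of \<open>q\<close> with the weight \<open>t\<close> placed on
  \<open>a\<close> represents \<open>b\<close> with a positive weight at \<open>a\<close>. Dropping
  the points of weight 0 reduces to \<open>caratheodory_pos\<close>.\<close>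

lemma caratheodory_through:
  fixes X :: "'a::euclidean_space set"
  assumes "finite X" "a \<in> X" "q \<in> convex hull X" "0 < t" "t \<le> 1"
    and b: "b = t *\<^sub>R a + (1 - t) *\<^sub>R q"
  shows "\<exists>B\<subseteq>X. a \<in> B \<and> \<not> affine_dependent B \<and> b \<in> rel_interior (convex hull B)"
proof -
  obtain w where w: "\<And>x. x \<in> X \<Longrightarrow> 0 \<le> w x" "sum w X = 1" "(\<Sum>x\<in>X. w x *\<^sub>R x) = q"
    using assms(3) by (auto simp: convex_hull_finite[OF assms(1)])
  define u where "u = (\<lambda>x. (if x = a then t else 0) + (1 - t) * w x)"
  define C where "C = {x\<in>X. u x > 0}"
  have u: "u x \<ge> 0" if "x \<in> X" for x
    using w(1)[OF that] assms by (auto simp: u_def)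
  have z: "u x = 0" if "x \<in> X - C" for x using u[of x] that by (force simp: C_def)
  have "u a > 0" using w(1)[OF assms(2)] assms by (auto simp: u_def intro!: add_pos_nonneg)
  have "sum u C = sum u X"
    using assms(1) z by (intro sum.mono_neutral_left) (auto simp: C_def)
  also have "\<dots> = 1" using w(2) assms(1,2)
    by (simp add: u_def sum.distrib flip: sum_distrib_left)
  finally have 1: "sum u C = 1" .
  have "(\<Sum>x\<in>C. u x *\<^sub>R x) = (\<Sum>x\<in>X. u x *\<^sub>R x)"
    using assms(1) z by (intro sum.mono_neutral_left) (auto simp: C_def)
  also have "\<dots> = (\<Sum>x\<in>X. if x = a then t *\<^sub>R x else 0) + (1 - t) *\<^sub>R (\<Sum>x\<in>X. w x *\<^sub>R x)"
    unfolding scaleR_right.sum sum.distrib[symmetric]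
    by (rule sum.cong) (auto simp: u_def scaleR_left_distrib)
  also have "\<dots> = b" using assms(1,2) w(3) by (simp add: b)
  finally have 2: "(\<Sum>x\<in>C. u x *\<^sub>R x) = b" .
  have "\<exists>B\<subseteq>C. a \<in> B \<and> \<not> affine_dependent B \<and> b \<in> rel_interior (convex hull B)"
    using assms(1,2) \<open>u a > 0\<close> 1 2 by (intro caratheodory_pos[of C a u]) (auto simp: C_def)
  then show ?thesis by (auto simp: C_def)
qed

section \<open>Circuits evaluated at sign vectors\<close>

lemma poly_eval_superset:
  assumes "finite A" "supp f \<subseteq> A"
  shows "poly_eval f v = (\<Sum>\<alpha>\<in>A. coef f \<alpha> * (\<Prod>i\<in>UNIV. (v $ i) ^ (\<alpha> $ i)))"
  unfolding poly_eval_def using assms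
  by (intro sum.mono_neutral_left) (auto simp: in_keys_iff)

text \<open>For positive \<open>c\<close> some exponent is odd, and flipping the sign of that single
  coordinate turns the monomial into -1; otherwise the all-ones vector works.\<close>

lemma ex_sign_vector:
  fixes \<beta> :: "nat ^ 'n::finite" and c :: real
  assumes "\<not> ((\<forall>i. even (\<beta> $ i)) \<and> c > 0)"
  shows "\<exists>s :: real ^ 'n. (\<forall>i. s $ i = 1 \<or> s $ i = -1) \<and>
    c * (\<Prod>i\<in>UNIV. (s $ i) ^ (\<beta> $ i)) = - \<bar>c\<bar>"
proof (cases "c \<le> 0")
  case True
  then show ?thesis by (intro exI[of _ "\<chi> i. 1"]) simp
next
  case False
  with assms obtain j where j: "odd (\<beta> $ j)" by auto
  define s :: "real ^ 'n" where "s = (\<chi> i. if i = j then - 1 else 1)"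
  have "(\<Prod>i\<in>UNIV. (s $ i) ^ (\<beta> $ i)) = (\<Prod>i\<in>UNIV. if i = j then -1 else 1 :: real)"
    using j by (intro prod.cong) (auto simp: s_def)
  also have "\<dots> = -1" by simp
  finally show ?thesis using False by (intro exI[of _ s]) (auto simp: s_def)
qed

text \<open>
  Evaluation at the points with coordinates \<open>\<plusminus>1\<close>, except for one coordinate \<open>\<plusminus>exp t\<close>, with the
  signs chosen such that the inner monomial becomes negative.
\<close>

lemma nonneg_exp_inequality:
  fixes g :: "'n::finite mpoly" and j :: 'n
  assumes "finite A" "\<beta> \<notin> A" "supp g \<subseteq> insert \<beta> A"
    and even: "\<And>\<alpha> i. \<alpha> \<in> A \<Longrightarrow> even (\<alpha> $ i)"
    and \<beta>: "\<not> ((\<forall>i. even (\<beta> $ i)) \<and> coef g \<beta> > 0)"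
    and nonneg: "\<And>v. poly_eval g v \<ge> 0"
  shows "\<bar>coef g \<beta>\<bar> * exp (t * real (\<beta> $ j)) \<le> (\<Sum>\<alpha>\<in>A. coef g \<alpha> * exp (t * real (\<alpha> $ j)))"
proof -
  obtain s :: "real ^ 'n" where s: "\<And>i. s $ i = 1 \<or> s $ i = -1"
    "coef g \<beta> * (\<Prod>i\<in>UNIV. (s $ i) ^ (\<beta> $ i)) = - \<bar>coef g \<beta>\<bar>"
    using ex_sign_vector[OF \<beta>] by blast
  define v :: "real ^ 'n" where "v = (\<chi> i. s $ i * (if i = j then exp t else 1))"
  have ev: "(\<Prod>i\<in>UNIV. (v $ i) ^ (\<alpha> $ i)) = (\<Prod>i\<in>UNIV. (s $ i) ^ (\<alpha> $ i)) * exp (t * real (\<alpha> $ j))"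
    for \<alpha> :: "nat ^ 'n"
  proof -
    have "(\<Prod>i\<in>UNIV. (v $ i) ^ (\<alpha> $ i)) =
      (\<Prod>i\<in>UNIV. (s $ i) ^ (\<alpha> $ i) * (if i = j then exp (t * real (\<alpha> $ j)) else 1))"
      by (intro prod.cong) (auto simp: v_def power_mult_distrib exp_of_nat_mult[symmetric] mult.commute)
    then show ?thesis by (simp add: prod.distrib)
  qed
  have one: "(\<Prod>i\<in>UNIV. (s $ i) ^ (\<alpha> $ i)) = 1" if "\<alpha> \<in> A" for \<alpha>
  proof (rule prod.neutral, rule ballI)
    fix i show "(s $ i) ^ (\<alpha> $ i) = 1"
      using s(1)[of i] even[OF that, of i] by auto
  qed
  have "0 \<le> poly_eval g v" by (rule nonneg)
  also have "\<dots> = coef g \<beta> * (\<Prod>i\<in>UNIV. (s $ i) ^ (\<beta> $ i)) * exp (t * real (\<beta> $ j)) +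
      (\<Sum>\<alpha>\<in>A. coef g \<alpha> * exp (t * real (\<alpha> $ j)))"
    using assms(1-3) one by (simp add: poly_eval_superset[of "insert \<beta> A"] ev)
  finally show ?thesis by (simp add: s(2))
qed

lemma circuit_inner_exponent:
  assumes "g \<in> circuits d" "\<beta> \<in> I_supp g"
  shows "I_supp g = {\<beta>}" "pt \<beta> \<in> rel_interior (New g)" "pt \<beta> \<notin> vertices (New g)"
proof -
  show *: "I_supp g = {\<beta>}" and "pt \<beta> \<in> rel_interior (New g)"
    using assms by (auto simp: circuits_def)
  have "pt \<beta> \<notin> pt ` S_supp g"
    using assms(2) by (auto simp: I_supp_def inj_eq[OF inj_pt])
  then show "pt \<beta> \<notin> vertices (New g)" using assms(1) by (auto simp: circuits_def)
qed

lemma nonneg_circuit_coef_sum: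
  assumes "g \<in> nonneg_circuits d" "\<beta> \<in> I_supp g"
  shows "\<bar>coef g \<beta>\<bar> \<le> (\<Sum>\<alpha>\<in>S_supp g. coef g \<alpha>)"
proof -
  have g: "I_supp g = {\<beta>}" "\<And>v. poly_eval g v \<ge> 0"
    using assms circuit_inner_exponent(1) by (auto simp: nonneg_circuits_def)
  \<comment> \<open>At \<open>t = 0\<close> all exponential factors are 1, so an arbitrary
    coordinate serves as \<open>j\<close>.\<close>
  have "\<bar>coef g \<beta>\<bar> * exp (0 * real (\<beta> $ undefined)) \<le>
      (\<Sum>\<alpha>\<in>S_supp g. coef g \<alpha> * exp (0 * real (\<alpha> $ undefined)))"
    using g assms(2) by (intro nonneg_exp_inequality) (auto simp: S_supp_def I_supp_def)
  then show ?thesis by simp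
qed

section \<open>Faces of the convex hull of \<open>S_supp f\<close>\<close>

text \<open>
  An extreme point of the convex hull of all supports is never an inner exponent of a circuit,
  so no cancellation takes place there.
\<close>

lemma circuits_supp_in_hull_S:
  fixes g :: "nat \<Rightarrow> 'n::finite mpoly"
  assumes g: "\<And>i. i < m \<Longrightarrow> g i \<in> circuits d" and f: "f = (\<Sum>i<m. g i)" and "i < m"
  shows "pt ` supp (g i) \<subseteq> convex hull (pt ` S_supp f)"
proof -
  define G where "G = (\<Union>i<m. supp (g i))"
  have coef_f: "coef f \<gamma> = (\<Sum>i<m. coef (g i) \<gamma>)" for \<gamma>
    by (simp add: f lookup_sum)
  have "finite G" by (simp add: G_def)
  have *: "pt \<gamma> \<in> pt ` S_supp f" if ex: "pt \<gamma> extreme_point_of (convex hull (pt ` G))" and "\<gamma> \<in> G" for \<gamma>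
  proof -
    \<comment> \<open>A point extreme in the hull of all supports stays extreme in each
      \<open>New (g i)\<close> that contains it, whereas an inner exponent is not a vertex
      there.\<close>
    have nI: "\<gamma> \<notin> I_supp (g i)" if "i < m" for i
    proof
      assume I: "\<gamma> \<in> I_supp (g i)"
      have "pt \<gamma> \<notin> vertices (New (g i))" using circuit_inner_exponent(3)[OF g[OF that] I] .
      moreover have "pt \<gamma> \<in> New (g i)" using I by (auto simp: New_def I_supp_def intro: hull_inc)
      moreover have "New (g i) \<subseteq> convex hull (pt ` G)"
        unfolding New_def using that by (intro hull_mono) (auto simp: G_def)
      ultimately show False using ex by (auto simp: vertices_def extreme_point_of_def)
    qed
    then have nn: "coef (g i) \<gamma> \<ge> 0" if "i < m" for i
      using that by (cases "\<gamma> \<in> supp (g i)") (auto simp: I_supp_def S_supp_def in_keys_iff intro: less_imp_le)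
    obtain j where j: "j < m" "\<gamma> \<in> supp (g j)" using \<open>\<gamma> \<in> G\<close> by (auto simp: G_def)
    then have S: "\<gamma> \<in> S_supp (g j)" using nI by (auto simp: I_supp_def)
    then have "coef f \<gamma> > 0" unfolding coef_f
      using nn j(1) by (intro sum_pos2[of _ j]) (auto simp: S_supp_def)
    with S show ?thesis by (auto simp: S_supp_def in_keys_iff)
  qed
  have "pt ` supp (g i) \<subseteq> convex hull (pt ` G)"
    using \<open>i < m\<close> by (auto simp: G_def intro!: hull_inc)
  also have "\<dots> = convex hull {x. x extreme_point_of (convex hull (pt ` G))}"
    using \<open>finite G\<close> by (intro Krein_Milman_Minkowski)
      (auto intro: finite_imp_compact_convex_hull convex_convex_hull)
  also have "\<dots> \<subseteq> convex hull (pt ` S_supp f)"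
  proof (rule hull_mono, rule subsetI)
    fix x assume "x \<in> {x. x extreme_point_of (convex hull (pt ` G))}"
    then have x: "x extreme_point_of (convex hull (pt ` G))" by simp
    then have "x \<in> pt ` G" by (rule extreme_point_of_convex_hull)
    with x * show "x \<in> pt ` S_supp f" by auto
  qed
  finally show ?thesis .
qed

text \<open>Positive weight of \<open>pt \<alpha>\<close> in a representation of
  \<open>pt \<beta>\<close> suffices: Caratheodory's theorem through \<open>pt \<alpha>\<close>
  yields a member of \<open>D_simplices f \<beta>\<close> with \<open>pt \<alpha>\<close> among its
  vertices.\<close>

lemma not_R_supp:
  assumes "\<alpha> \<in> S_supp f" "\<beta> \<in> I_supp f" "q \<in> convex hull (pt ` S_supp f)" "0 < t" "t \<le> 1"
    "pt \<beta> = t *\<^sub>R pt \<alpha> + (1 - t) *\<^sub>R q"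
  shows "\<alpha> \<notin> R_supp f"
proof -
  have "finite (pt ` S_supp f)" by (simp add: S_supp_def)
  then obtain B where B: "B \<subseteq> pt ` S_supp f" "pt \<alpha> \<in> B" "\<not> affine_dependent B"
    "pt \<beta> \<in> rel_interior (convex hull B)"
    using caratheodory_through[of "pt ` S_supp f" "pt \<alpha>" q t "pt \<beta>"] assms by blast
  have "vertices (convex hull B) = B"
    using B(3) by (auto simp: vertices_def extreme_point_of_convex_hull_affine_independent)
  moreover from this have "is_simplex (convex hull B)"
    using B(3) finite_subset[OF B(1) \<open>finite (pt ` S_supp f)\<close>]
    by (auto simp: is_simplex_def polytope_def)
  ultimately have "convex hull B \<in> D_simplices f \<beta>" "pt \<alpha> \<in> vertices (convex hull B)"
    using B by (auto simp: D_simplices_def)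
  with assms(2) show ?thesis by (auto simp: R_supp_def)
qed

text \<open>
  \<open>face_exponents f\<close> collects the exponents lying in the smallest face of \<open>conv \<S>(f)\<close> that contains
  a given element of \<open>\<I>(f)\<close>.
\<close>

definition face_exponents :: "'n::finite mpoly \<Rightarrow> (nat ^ 'n) set" where
  "face_exponents f = {\<gamma>. \<exists>\<beta>\<in>I_supp f. \<exists>t q. 0 < t \<and> t \<le> 1 \<and> q \<in> convex hull (pt ` S_supp f) \<and>
     pt \<beta> = t *\<^sub>R pt \<gamma> + (1 - t) *\<^sub>R q}"

text \<open>A face containing a relative interior point of a convex subset contains the whole
  subset. Explicitly: the segment from \<open>pt \<alpha>\<close> to \<open>pt \<beta>\<close> is
  prolonged inside \<open>New g\<close>, and the resulting representation of
  \<open>pt \<beta>\<close> is inserted into that of \<open>pt \<beta>'\<close>.\<close>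

lemma face_exponents_circuit:
  assumes g: "g \<in> circuits d" "\<beta> \<in> I_supp g" "\<beta> \<in> face_exponents f"
    and sub: "pt ` supp g \<subseteq> convex hull (pt ` S_supp f)"
  shows "supp g \<subseteq> face_exponents f"
proof
  fix \<alpha> assume \<alpha>: "\<alpha> \<in> supp g"
  define K where "K = convex hull (pt ` S_supp f)"
  have "convex K" by (simp add: K_def)
  obtain \<beta>' t q where \<beta>': "\<beta>' \<in> I_supp f" "0 < t" "t \<le> 1" "q \<in> K"
    "pt \<beta>' = t *\<^sub>R pt \<beta> + (1 - t) *\<^sub>R q"
    using g(3) by (auto simp: face_exponents_def K_def)
  have "New g \<subseteq> K" unfolding New_def K_def using sub by (intro hull_minimal) auto
  have "pt \<alpha> \<in> New g" using \<alpha> by (auto simp: New_def intro: hull_inc)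
  moreover have "convex (New g)" by (simp add: New_def)
  ultimately obtain e where e: "e > 1" "(1 - e) *\<^sub>R pt \<alpha> + e *\<^sub>R pt \<beta> \<in> New g"
    using convex_rel_interior_iff[of "New g" "pt \<beta>"] circuit_inner_exponent(2)[OF g(1,2)] by auto
  define r where "r = (1 - e) *\<^sub>R pt \<alpha> + e *\<^sub>R pt \<beta>"
  \<comment> \<open>Solving the definition of \<open>r\<close> for \<open>pt \<beta>\<close> gives
    \<open>pt \<alpha>\<close> the weight \<open>s\<close>.\<close>
  define s where "s = 1 - 1 / e"
  have s: "0 < s" "s < 1" using e by (auto simp: s_def)
  have "r \<in> K" using e \<open>New g \<subseteq> K\<close> by (auto simp: r_def)
  have \<beta>_eq: "pt \<beta> = s *\<^sub>R pt \<alpha> + (1 - s) *\<^sub>R r"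
    using e by (simp add: s_def r_def vec_eq_iff field_simps)
  have ts: "0 < t * s" "t * s < 1" using s \<beta>'(2,3) mult_le_less_imp_less[of t 1 s 1] by auto
  \<comment> \<open>After the insertion \<open>pt \<alpha>\<close> has weight \<open>t * s\<close>;
    \<open>q'\<close> is the rest, normalized to a convex combination of \<open>r\<close> and
    \<open>q\<close>.\<close>
  define q' where "q' = (t * (1 - s) / (1 - t * s)) *\<^sub>R r + ((1 - t) / (1 - t * s)) *\<^sub>R q"
  have "t * (1 - s) / (1 - t * s) + (1 - t) / (1 - t * s) = 1"
    using ts by (simp add: add_divide_distrib[symmetric] algebra_simps)
  then have "q' \<in> K" unfolding q'_def
    using \<open>r \<in> K\<close> \<open>q \<in> K\<close> ts s \<beta>' by (intro convexD[OF \<open>convex K\<close>]) auto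
  have "(1 - t * s) *\<^sub>R q' = (t * (1 - s)) *\<^sub>R r + (1 - t) *\<^sub>R q"
    using ts by (simp add: q'_def scaleR_right_distrib)
  then have "pt \<beta>' = (t * s) *\<^sub>R pt \<alpha> + (1 - t * s) *\<^sub>R q'"
    by (simp add: \<beta>'(5) \<beta>_eq scaleR_right_distrib)
  then show "\<alpha> \<in> face_exponents f"
    unfolding face_exponents_def using \<beta>'(1) ts \<open>q' \<in> K\<close> 
    by (auto simp: K_def intro!: bexI[of _ \<beta>'] exI[of _ "t * s"] exI[of _ q'])
qed

section \<open>The coefficient inequality\<close>

lemma SONC_coef_inequality:
  fixes f :: "'n::finite mpoly"
  assumes "f \<in> SONC d"
  shows "(\<Sum>\<beta>\<in>I_supp f. \<bar>coef f \<beta>\<bar>) \<le> (\<Sum>\<alpha>\<in>S_supp f - R_supp f. coef f \<alpha>)"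
proof -
  obtain m g where g: "\<And>i. i < m \<Longrightarrow> g i \<in> nonneg_circuits d" and f: "f = (\<Sum>i<m::nat. g i)"
    using assms by (auto simp: SONC_def)
  have gc: "\<And>i. i < m \<Longrightarrow> g i \<in> circuits d" using g by (auto simp: nonneg_circuits_def)
  note sub = circuits_supp_in_hull_S[OF gc f]
  define U where "U = face_exponents f"
  define G where "G = (\<Union>i<m. supp (g i))"
  have "finite G" by (simp add: G_def)
  have coef_f: "coef f \<gamma> = (\<Sum>i<m. coef (g i) \<gamma>)" for \<gamma>
    by (simp add: f lookup_sum)
  have suppG: "supp f \<subseteq> G"
  proof
    fix \<gamma> assume "\<gamma> \<in> supp f"
    then have "(\<Sum>i<m. coef (g i) \<gamma>) \<noteq> 0" by (simp add: in_keys_iff coef_f)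
    then obtain i where "i < m" "coef (g i) \<gamma> \<noteq> 0" by (meson lessThan_iff sum.not_neutral_contains_not_neutral)
    then show "\<gamma> \<in> G" by (auto simp: G_def in_keys_iff)
  qed
  have IU: "I_supp f \<subseteq> U"
  proof
    fix \<beta> assume \<beta>: "\<beta> \<in> I_supp f"
    then obtain i where "i < m" "\<beta> \<in> supp (g i)" using suppG by (auto simp: I_supp_def G_def)
    then have "pt \<beta> \<in> convex hull (pt ` S_supp f)" using sub by blast
    \<comment> \<open>An inner exponent lies in its own smallest face: with \<open>t = 1\<close> the
      point \<open>q\<close> gets weight 0.\<close>
    then show "\<beta> \<in> U" using \<beta> unfolding U_def face_exponents_def
      by (intro CollectI bexI[of _ \<beta>] exI[of _ 1] exI[of _ "pt \<beta>"]) auto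
  qed
  have SU: "S_supp f \<inter> U \<subseteq> S_supp f - R_supp f"
    using not_R_supp by (fastforce simp: U_def face_exponents_def)
  \<comment> \<open>\<open>e i\<close> lists the terms of \<open>g i\<close> at a sign vector that
    makes its inner term negative; this vector may vary with \<open>i\<close>.\<close>
  define e where "e = (\<lambda>i \<gamma>. if \<gamma> \<in> I_supp (g i) then - \<bar>coef (g i) \<gamma>\<bar> else coef (g i) \<gamma>)"
  have e_le: "e i \<gamma> \<le> coef (g i) \<gamma>" for i \<gamma> by (auto simp: e_def)
  have e_nn: "e i \<gamma> \<ge> 0" if "\<gamma> \<notin> I_supp (g i)" for i \<gamma>
    using that by (cases "\<gamma> \<in> supp (g i)") (auto simp: e_def I_supp_def S_supp_def in_keys_iff)
  \<comment> \<open>Either the inner exponent lies in \<open>U\<close>, and then so does the whole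
    support and the inequality of the circuit applies, or only nonnegative terms are summed.\<close>
  have e_sum: "0 \<le> (\<Sum>\<gamma>\<in>G \<inter> U. e i \<gamma>)" if i: "i < m" for i
  proof (cases "I_supp (g i) \<inter> U = {}")
    case True
    then show ?thesis by (intro sum_nonneg e_nn) auto
  next
    case False
    then obtain \<beta> where \<beta>: "\<beta> \<in> I_supp (g i)" "\<beta> \<in> U" by auto
    have "supp (g i) \<subseteq> U"
      using face_exponents_circuit[OF gc[OF i] \<beta>(1)] \<beta>(2) sub[OF _ i] by (auto simp: U_def)
    then have sU: "supp (g i) \<subseteq> G \<inter> U" using i by (auto simp: G_def)
    have I: "I_supp (g i) = {\<beta>}" using circuit_inner_exponent(1)[OF gc[OF i] \<beta>(1)] .
    have "\<beta> \<notin> S_supp (g i)" "supp (g i) = insert \<beta> (S_supp (g i))" "finite (S_supp (g i))"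
      using I by (auto simp: I_supp_def S_supp_def)
    have "(\<Sum>\<gamma>\<in>G \<inter> U. e i \<gamma>) = (\<Sum>\<gamma>\<in>supp (g i). e i \<gamma>)"
      using sU \<open>finite G\<close> by (intro sum.mono_neutral_right) (auto simp: e_def in_keys_iff)
    also have "\<dots> = - \<bar>coef (g i) \<beta>\<bar> + (\<Sum>\<gamma>\<in>S_supp (g i). e i \<gamma>)"
      using \<open>\<beta> \<notin> S_supp (g i)\<close> \<open>supp (g i) = _\<close> \<open>finite (S_supp (g i))\<close> \<beta>(1) by (simp add: e_def)
    also have "(\<Sum>\<gamma>\<in>S_supp (g i). e i \<gamma>) = (\<Sum>\<gamma>\<in>S_supp (g i). coef (g i) \<gamma>)"
      by (intro sum.cong) (auto simp: e_def I_supp_def)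
    finally show ?thesis using nonneg_circuit_coef_sum[OF g[OF i] \<beta>(1)] by simp
  qed
  define E where "E = (\<lambda>\<gamma>. if \<gamma> \<in> I_supp f then - \<bar>coef f \<gamma>\<bar> else coef f \<gamma>)"
  have eE: "(\<Sum>i<m. e i \<gamma>) \<le> E \<gamma>" for \<gamma>
  \<comment> \<open>This controls cancellation. At an exponent with an odd entry all circuit terms
    are inner ones and the triangle inequality applies. Otherwise \<open>E \<gamma>\<close> is the
    coefficient itself, since an even exponent in \<open>I_supp f\<close> has a negative
    coefficient.\<close>
  proof (cases "\<gamma> \<in> I_supp f \<and> (\<exists>i. odd (\<gamma> $ i))")
    case True
    have "e i \<gamma> = - \<bar>coef (g i) \<gamma>\<bar>" for i
      using True by (auto simp: e_def I_supp_def S_supp_def in_keys_iff)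
    then have "(\<Sum>i<m. e i \<gamma>) = - (\<Sum>i<m. \<bar>coef (g i) \<gamma>\<bar>)" by (simp add: sum_negf)
    also have "\<dots> \<le> - \<bar>coef f \<gamma>\<bar>" unfolding coef_f using sum_abs by auto
    finally show ?thesis using True by (simp add: E_def)
  next
    case False
    then have "E \<gamma> = coef f \<gamma>" by (auto simp: E_def I_supp_def S_supp_def)
    then show ?thesis by (auto simp: coef_f intro!: sum_mono e_le)
  qed
  have "0 \<le> (\<Sum>i<m. \<Sum>\<gamma>\<in>G \<inter> U. e i \<gamma>)" by (intro sum_nonneg e_sum) auto
  also have "\<dots> = (\<Sum>\<gamma>\<in>G \<inter> U. \<Sum>i<m. e i \<gamma>)" by (rule sum.swap)
  also have "\<dots> \<le> (\<Sum>\<gamma>\<in>G \<inter> U. E \<gamma>)" by (intro sum_mono eE)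
  also have "\<dots> = (\<Sum>\<gamma>\<in>supp f \<inter> U. E \<gamma>)"
    using \<open>finite G\<close> suppG by (intro sum.mono_neutral_right) (auto simp: E_def in_keys_iff)
  also have "supp f \<inter> U = (S_supp f \<inter> U) \<union> I_supp f"
    using IU by (auto simp: I_supp_def S_supp_def)
  also have "(\<Sum>\<gamma>\<in>(S_supp f \<inter> U) \<union> I_supp f. E \<gamma>) =
      (\<Sum>\<gamma>\<in>S_supp f \<inter> U. E \<gamma>) + (\<Sum>\<gamma>\<in>I_supp f. E \<gamma>)"
    by (intro sum.union_disjoint) (auto simp: I_supp_def S_supp_def)
  also have "(\<Sum>\<gamma>\<in>I_supp f. E \<gamma>) = - (\<Sum>\<gamma>\<in>I_supp f. \<bar>coef f \<gamma>\<bar>)"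
    by (simp add: E_def sum_negf)
  also have "(\<Sum>\<gamma>\<in>S_supp f \<inter> U. E \<gamma>) = (\<Sum>\<gamma>\<in>S_supp f \<inter> U. coef f \<gamma>)"
    by (intro sum.cong) (auto simp: E_def I_supp_def)
  also have "(\<Sum>\<gamma>\<in>S_supp f \<inter> U. coef f \<gamma>) \<le> (\<Sum>\<gamma>\<in>S_supp f - R_supp f. coef f \<gamma>)"
    using SU by (intro sum_mono2) (auto simp: S_supp_def)
  finally show ?thesis by simp
qed

section \<open>The case of equality\<close>

lemma lookup_summand:
  assumes "\<beta> \<in> I_supp f"
  shows "coef (summand f mu nu \<beta> k) \<gamma> =
    (if \<gamma> \<in> S_supp f - R_supp f then mu \<gamma> \<beta> k * coef f \<gamma>
     else if \<gamma> = \<beta> then nu \<beta> k * coef f \<beta> else 0)"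
proof -
  have "finite (S_supp f - R_supp f)" "\<beta> \<notin> S_supp f" using assms by (auto simp: S_supp_def I_supp_def)
  then show ?thesis
    by (auto simp: summand_def lookup_add lookup_sum lookup_single when_def sum.delta)
qed

text \<open>This is \<open>nonneg_exp_inequality\<close> for one summand. The case
  \<open>nu \<beta> k = 0\<close> is covered: the coefficient at \<beta> is then 0, which satisfies
  the sign condition.\<close>

lemma summand_exp_inequality:
  fixes f :: "'n::finite mpoly" and j :: 'n
  assumes "\<beta> \<in> I_supp f" "summand f mu nu \<beta> k \<in> nonneg_circuits d" "nu \<beta> k \<ge> 0"
  shows "nu \<beta> k * \<bar>coef f \<beta>\<bar> * exp (t * real (\<beta> $ j)) \<le>
    (\<Sum>\<alpha>\<in>S_supp f - R_supp f. mu \<alpha> \<beta> k * coef f \<alpha> * exp (t * real (\<alpha> $ j)))"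
proof -
  have \<beta>: "\<beta> \<notin> S_supp f" "\<beta> \<in> supp f" using assms(1) by (auto simp: I_supp_def)
  then have b: "coef (summand f mu nu \<beta> k) \<beta> = nu \<beta> k * coef f \<beta>"
    by (simp add: lookup_summand[OF assms(1)])
  have "\<bar>coef (summand f mu nu \<beta> k) \<beta>\<bar> * exp (t * real (\<beta> $ j)) \<le>
    (\<Sum>\<alpha>\<in>S_supp f - R_supp f. coef (summand f mu nu \<beta> k) \<alpha> * exp (t * real (\<alpha> $ j)))"
  proof (rule nonneg_exp_inequality)
    show "supp (summand f mu nu \<beta> k) \<subseteq> insert \<beta> (S_supp f - R_supp f)"
      by (auto simp: in_keys_iff lookup_summand[OF assms(1)] split: if_splits)
    show "\<not> ((\<forall>i. even (\<beta> $ i)) \<and> 0 < coef (summand f mu nu \<beta> k) \<beta>)"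
      using \<beta> assms(3) by (auto simp: b S_supp_def zero_less_mult_iff)
  qed (use \<beta> assms(2) in \<open>auto simp: S_supp_def nonneg_circuits_def\<close>)
  then show ?thesis using assms(3) unfolding b by (simp add: lookup_summand[OF assms(1)] abs_mult)
qed

text \<open>
  Equality at \<open>t = 0\<close> makes \<open>0\<close> a minimum of the difference of both sides, so the derivative
  vanishes there.
\<close>

lemma exp_inequality_imp_moment:
  fixes c x :: "'a \<Rightarrow> real"
  assumes le: "\<And>t. N * exp (t * y) \<le> (\<Sum>a\<in>A. c a * exp (t * x a))" and eq: "N = sum c A"
  shows "N * y = (\<Sum>a\<in>A. c a * x a)"
proof -
  define \<phi> where "\<phi> = (\<lambda>t. (\<Sum>a\<in>A. c a * exp (t * x a)) - N * exp (t * y))"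
  have "(\<phi> has_real_derivative (\<Sum>a\<in>A. c a * x a) - N * y) (at 0)"
    unfolding \<phi>_def by (auto intro!: derivative_eq_intros sum.cong)
  moreover have "\<phi> 0 \<le> \<phi> t" for t using le[of t] eq by (simp add: \<phi>_def)
  ultimately have "(\<Sum>a\<in>A. c a * x a) - N * y = 0"
    by (intro DERIV_local_min[where d = 1 and f = \<phi> and x = 0]) auto
  then show ?thesis by simp
qed

text \<open>Affine independence for an indexed family: the coefficients are carried to the points
  along the inverse of \<open>p\<close>, as \<open>affine_dependent\<close> speaks about sets of
  points.\<close>

lemma affine_independent_coeffs_zero:
  assumes "\<not> affine_dependent (p ` W)" "inj_on p W" "finite W"
    "sum c W = 0" "(\<Sum>a\<in>W. c a *\<^sub>R p a) = 0" "a \<in> W"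
  shows "c a = 0"
proof (rule ccontr)
  assume "c a \<noteq> 0"
  define U where "U = c \<circ> the_inv_into W p"
  have U: "U (p b) = c b" if "b \<in> W" for b
    using that assms(2) by (simp add: U_def the_inv_into_f_f)
  have "sum U (p ` W) = 0" "(\<Sum>v\<in>p ` W. U v *\<^sub>R v) = 0" "U (p a) \<noteq> 0"
    using assms U \<open>c a \<noteq> 0\<close> by (simp_all add: sum.reindex)
  with assms(1,3,6) show False
    using affine_dependent_explicit_finite[of "p ` W"] by blast
qed

text \<open>The gaps \<open>h\<close> of the summands are nonnegative. Since the \<open>mu\<close>
  and the \<open>nu\<close> are normalized to sum 1, the gaps add up to the gap in the inequality
  for \<open>f\<close>, which is 0; so each of them is 0.\<close>

lemma decomposition_summand_eq:
  fixes f :: "'n::finite mpoly"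
  assumes dec: "cancellation_free_decomposition d f \<Delta> lam mu nu"
    and eq: "(\<Sum>\<beta>\<in>I_supp f. \<bar>coef f \<beta>\<bar>) = (\<Sum>\<alpha>\<in>S_supp f - R_supp f. coef f \<alpha>)"
    and \<beta>: "\<beta> \<in> I_supp f" and k: "k \<in> {1..N_simplices f \<beta>}"
  shows "nu \<beta> k * \<bar>coef f \<beta>\<bar> = (\<Sum>\<alpha>\<in>S_supp f - R_supp f. mu \<alpha> \<beta> k * coef f \<alpha>)"
proof -
  define A where "A = S_supp f - R_supp f"
  define P where "P = Sigma (I_supp f) (\<lambda>\<beta>. {1..N_simplices f \<beta>})"
  define h where "h = (\<lambda>(\<beta>, k). (\<Sum>\<alpha>\<in>A. mu \<alpha> \<beta> k * coef f \<alpha>) - nu \<beta> k * \<bar>coef f \<beta>\<bar>)"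
  have fin: "finite (I_supp f)" "finite P" by (simp_all add: I_supp_def P_def)
  have h: "h p \<ge> 0" if "p \<in> P" for p
  proof -
    obtain \<beta> k where p: "p = (\<beta>, k)" "\<beta> \<in> I_supp f" "k \<in> {1..N_simplices f \<beta>}"
      using \<open>p \<in> P\<close> by (auto simp: P_def)
    then have "summand f mu nu \<beta> k \<in> nonneg_circuits d" "nu \<beta> k \<ge> 0"
      using dec by (auto simp: cancellation_free_decomposition_def)
    from summand_exp_inequality[OF p(2) this, where t = 0] show ?thesis
      by (simp add: p h_def A_def)
  qed
  have "sum h P = (\<Sum>\<beta>\<in>I_supp f. \<Sum>k=1..N_simplices f \<beta>. h (\<beta>, k))"
    unfolding P_def using fin(1) by (subst sum.Sigma) auto
  also have "\<dots> = (\<Sum>\<beta>\<in>I_supp f. \<Sum>k=1..N_simplices f \<beta>. \<Sum>\<alpha>\<in>A. mu \<alpha> \<beta> k * coef f \<alpha>)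
      - (\<Sum>\<beta>\<in>I_supp f. (\<Sum>k=1..N_simplices f \<beta>. nu \<beta> k) * \<bar>coef f \<beta>\<bar>)"
    by (simp add: h_def sum_subtractf sum_distrib_right)
  also have "(\<Sum>\<beta>\<in>I_supp f. (\<Sum>k=1..N_simplices f \<beta>. nu \<beta> k) * \<bar>coef f \<beta>\<bar>) =
      (\<Sum>\<beta>\<in>I_supp f. \<bar>coef f \<beta>\<bar>)"
    using dec by (intro sum.cong) (auto simp: cancellation_free_decomposition_def)
  also have "(\<Sum>\<beta>\<in>I_supp f. \<Sum>k=1..N_simplices f \<beta>. \<Sum>\<alpha>\<in>A. mu \<alpha> \<beta> k * coef f \<alpha>) =
      (\<Sum>\<alpha>\<in>A. (\<Sum>\<beta>\<in>I_supp f. \<Sum>k=1..N_simplices f \<beta>. mu \<alpha> \<beta> k) * coef f \<alpha>)"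
    by (simp add: sum_distrib_right sum.swap[of _ A])
  also have "\<dots> = (\<Sum>\<alpha>\<in>A. coef f \<alpha>)"
    using dec by (intro sum.cong) (auto simp: cancellation_free_decomposition_def A_def)
  finally have "sum h P = 0" using eq by (simp add: A_def)
  then have "h (\<beta>, k) = 0"
    using sum_nonneg_eq_0_iff[OF fin(2) h] \<beta> k by (auto simp: P_def)
  then show ?thesis by (simp add: h_def A_def)
qed

text \<open>On the vertices of the simplex, both sides have the same total and the same first
  moment. Their difference is thus an affine relation among affinely independent points and
  vanishes.\<close>

lemma decomposition_coeffs:
  fixes f :: "'n::finite mpoly"
  assumes dec: "cancellation_free_decomposition d f \<Delta> lam mu nu"
    and eq: "(\<Sum>\<beta>\<in>I_supp f. \<bar>coef f \<beta>\<bar>) = (\<Sum>\<alpha>\<in>S_supp f - R_supp f. coef f \<alpha>)"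
    and \<beta>: "\<beta> \<in> I_supp f" and k: "k \<in> {1..N_simplices f \<beta>}" and \<alpha>: "\<alpha> \<in> S_supp f - R_supp f"
  shows "mu \<alpha> \<beta> k * coef f \<alpha> = nu \<beta> k * lam \<alpha> \<beta> k * \<bar>coef f \<beta>\<bar>"
proof -
  define A where "A = S_supp f - R_supp f"
  define W where "W = {\<alpha>\<in>S_supp f. pt \<alpha> \<in> vertices (\<Delta> \<beta> k)}"
  define N where "N = nu \<beta> k * \<bar>coef f \<beta>\<bar>"
  define c where "c = (\<lambda>\<alpha>. mu \<alpha> \<beta> k * coef f \<alpha>)"
  have fin: "finite A" "finite W" by (simp_all add: A_def W_def S_supp_def)
  have "\<Delta> \<beta> k \<in> D_simplices f \<beta>"
    using dec \<beta> k bij_betw_apply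
    unfolding cancellation_free_decomposition_def simplex_enumeration_def by metis
  \<comment> \<open>\<open>W \<subseteq> A\<close> because no vertex of a simplex in
    \<open>D_simplices f \<beta>\<close> belongs to \<open>R_supp f\<close>.\<close>
  then have D: "\<not> affine_dependent (vertices (\<Delta> \<beta> k))" "vertices (\<Delta> \<beta> k) \<subseteq> pt ` S_supp f"
    and WA: "W \<subseteq> A"
    using \<beta> by (auto simp: D_simplices_def is_simplex_def W_def A_def R_supp_def)
  have ptW: "pt ` W = vertices (\<Delta> \<beta> k)" using D(2) by (auto simp: W_def)
  have "barycentric_coords f \<Delta> lam" using dec by (simp add: cancellation_free_decomposition_def)
  then have lam: "(\<Sum>\<alpha>\<in>W. lam \<alpha> \<beta> k) = 1" "(\<Sum>\<alpha>\<in>W. lam \<alpha> \<beta> k *\<^sub>R pt \<alpha>) = pt \<beta>"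
    "\<And>\<alpha>. \<alpha> \<in> A - W \<Longrightarrow> lam \<alpha> \<beta> k = 0"
    using \<beta> k unfolding barycentric_coords_def Let_def W_def A_def by blast+
  have s: "summand f mu nu \<beta> k \<in> nonneg_circuits d" "nu \<beta> k \<ge> 0"
    and mu: "\<And>\<alpha>. \<alpha> \<in> A \<Longrightarrow> mu \<alpha> \<beta> k = 0 \<longleftrightarrow> lam \<alpha> \<beta> k = 0"
    using dec \<beta> k by (auto simp: cancellation_free_decomposition_def A_def)
  \<comment> \<open>Off the simplex \<open>lam\<close> is 0, and \<open>mu\<close> has the same
    zeros as \<open>lam\<close>.\<close>
  have c0: "c \<alpha> = 0" if "\<alpha> \<in> A - W" for \<alpha> using lam(3) mu that by (auto simp: c_def)
  have N: "N = sum c A"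
    using decomposition_summand_eq[OF dec eq \<beta> k] by (simp add: N_def c_def A_def)
  have cW: "sum c W = N"
    unfolding N using fin(1) WA c0 by (intro sum.mono_neutral_left) auto
  have "(\<Sum>\<alpha>\<in>W. c \<alpha> *\<^sub>R pt \<alpha>) = (\<Sum>\<alpha>\<in>A. c \<alpha> *\<^sub>R pt \<alpha>)"
    using fin(1) WA c0 by (intro sum.mono_neutral_left) auto
  also have "\<dots> = N *\<^sub>R pt \<beta>"
  proof (rule vec_eq_iff[THEN iffD2], rule allI)
    fix j
    \<comment> \<open>The inequality for coordinate \<open>j\<close> is an equality at
      \<open>t = 0\<close> by \<open>N\<close>, so its derivative there gives this coordinate of the
      moment identity.\<close>
    have "N * real (\<beta> $ j) = (\<Sum>\<alpha>\<in>A. c \<alpha> * real (\<alpha> $ j))"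
      using summand_exp_inequality[OF \<beta> s] N
      by (intro exp_inequality_imp_moment) (auto simp: N_def c_def A_def)
    then show "(\<Sum>\<alpha>\<in>A. c \<alpha> *\<^sub>R pt \<alpha>) $ j = (N *\<^sub>R pt \<beta>) $ j"
      by (simp add: pt_def)
  qed
  finally have moment: "(\<Sum>\<alpha>\<in>W. c \<alpha> *\<^sub>R pt \<alpha>) = N *\<^sub>R pt \<beta>" .
  define w where "w = (\<lambda>\<alpha>. c \<alpha> - N * lam \<alpha> \<beta> k)"
  have "sum w W = 0"
    using cW lam(1) by (simp add: w_def sum_subtractf flip: sum_distrib_left)
  moreover have "(\<Sum>\<alpha>\<in>W. w \<alpha> *\<^sub>R pt \<alpha>) = 0"
    using moment lam(2)
    by (simp add: w_def scaleR_left_diff_distrib sum_subtractf flip: scaleR_scaleR scaleR_right.sum)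
  ultimately have "w \<alpha> = 0" if "\<alpha> \<in> W" for \<alpha>
    using affine_independent_coeffs_zero[of pt W w \<alpha>] D(1) ptW fin(2) that inj_on_subset[OF inj_pt]
    by auto
  moreover have "w \<alpha> = 0" if "\<alpha> \<in> A - W" for \<alpha> using c0 lam(3) that by (simp add: w_def)
  ultimately have "w \<alpha> = 0" using \<alpha> by (auto simp: A_def)
  then show ?thesis by (simp add: w_def c_def N_def)
qed

theorem theorem3p1:
  fixes f :: "'n::finite mpoly" and d :: nat
  assumes "d \<ge> 1" and "f \<in> SONC d"
  shows "(\<Sum>\<beta>\<in>I_supp f. \<bar>coef f \<beta>\<bar>) \<le> (\<Sum>\<alpha>\<in>S_supp f - R_supp f. coef f \<alpha>) \<and>
    ((\<Sum>\<beta>\<in>I_supp f. \<bar>coef f \<beta>\<bar>) = (\<Sum>\<alpha>\<in>S_supp f - R_supp f. coef f \<alpha>) \<longrightarrow>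
      (\<forall>\<Delta> lam mu nu. cancellation_free_decomposition d f \<Delta> lam mu nu \<longrightarrow>
        (\<forall>\<beta>\<in>I_supp f. \<forall>k\<in>{1..N_simplices f \<beta>}. \<forall>\<alpha>\<in>S_supp f - R_supp f.
           mu \<alpha> \<beta> k * coef f \<alpha> = nu \<beta> k * lam \<alpha> \<beta> k * \<bar>coef f \<beta>\<bar>)))"
  using SONC_coef_inequality[OF assms(2)] decomposition_coeffs by blast

end
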